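(* Let $d\ge 4$ be an integer. The set of matrices in $ESL_2(\mathbb{Z}/\bar d\mathbb{Z})$ having determinant $+1$ and trace $d-1$ consists of: (1) the single conjugacy class $[F_z]$ if $d\not\equiv 3,6\pmod 9$; (2) the two disjoint conjugacy classes $[F_z]$, $[F_a]$ if $d\equiv 3\pmod 9$; (3) the two disjoint conjugacy classes $[F_z]$, $[F_a']$ if $d\equiv 6\pmod 9$, where $[F]$ denotes the conjugacy class of $F$ in the group $ESL_2(\mathbb{Z}/\bar d\mathbb{Z})$.
   Context: $\bar d=d$ if $d$ is odd and $\bar d=2d$ if $d$ is even. $ESL_2(\mathbb{Z}/\bar d\mathbb{Z})$ is the group of matrices in $GL_2(\mathbb{Z}/\bar d\mathbb{Z})$ with determinant $\pm1$. Define (entries read modulo $\bar d$) $F_z=\begin{pmatrix}0&d-1\\ d+1&d-1\end{pmatrix}$; if $d\equiv 3\pmod 9$, $F_a=\begin{pmatrix}1&d+3\\ \frac{4d-3}{3}&d-2\end{pmatrix}$; if $d\equiv 6\pmod 9$, $F_a'=\begin{pmatrix}1&d+3\\ \frac{2d-3}{3}&d-2\end{pmatrix}$. *)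

theory Defs
  imports "HOL-Analysis.Determinants" "HOL-Analysis.Cartesian_Euclidean_Space"
    "HOL-Algebra.Group" "HOL-Number_Theory.Residues"
begin

text \<open>
  A matrix over the integers modulo \<open>n\<close> is represented by its unique integer representative with
  entries in the carrier \<open>{0..n - 1}\<close> of \<^const>\<open>residue_ring\<close>. Determinant and trace of the class
  are those of the representative, read modulo \<open>n\<close>.
\<close>

definition dbar :: "int \<Rightarrow> int"
  where "dbar d = (if odd d then d else 2 * d)"

definition mat_red :: "int \<Rightarrow> int^2^2 \<Rightarrow> int^2^2"
  where "mat_red n A = (\<chi> i j. A $ i $ j mod n)"

definition mat2 :: "int \<Rightarrow> int \<Rightarrow> int \<Rightarrow> int \<Rightarrow> int^2^2"
  where "mat2 a b c e = vector [vector [a, b], vector [c, e]]"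

definition M2 :: "int \<Rightarrow> (int^2^2) monoid"
  where "M2 n = \<lparr>carrier = {A. \<forall>i j. A $ i $ j \<in> carrier (residue_ring n)},
                 monoid.mult = (\<lambda>A B. mat_red n (A ** B)),
                 one = mat_red n (mat 1)\<rparr>"

definition GL2 :: "int \<Rightarrow> (int^2^2) monoid"
  where "GL2 n = units_of (M2 n)"

definition ESL2 :: "int \<Rightarrow> (int^2^2) monoid"
  where "ESL2 n = (GL2 n)\<lparr>carrier :=
           {A \<in> carrier (GL2 n). [det A = 1] (mod n) \<or> [det A = -1] (mod n)}\<rparr>"

definition conjugacy_class :: "('a, 'b) monoid_scheme \<Rightarrow> 'a \<Rightarrow> 'a set"
  where "conjugacy_class G x = {g \<otimes>\<^bsub>G\<^esub> x \<otimes>\<^bsub>G\<^esub> inv\<^bsub>G\<^esub> g | g. g \<in> carrier G}"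

definition Fz :: "int \<Rightarrow> int^2^2"
  where "Fz d = mat_red (dbar d) (mat2 0 (d - 1) (d + 1) (d - 1))"

text \<open>In the next two definitions the division by 3 is exact when \<open>3 dvd d\<close>, the only case in which
  they are used.\<close>

definition Fa :: "int \<Rightarrow> int^2^2"
  where "Fa d = mat_red (dbar d) (mat2 1 (d + 3) ((4 * d - 3) div 3) (d - 2))"

definition Fa' :: "int \<Rightarrow> int^2^2"
  where "Fa' d = mat_red (dbar d) (mat2 1 (d + 3) ((2 * d - 3) div 3) (d - 2))"

lemma mat_red_nth [simp]: "mat_red n A $ i $ j = A $ i $ j mod n"
  by (simp add: mat_red_def)

lemma mult_nth_2: "((A :: int^2^2) ** B) $ i $ j = A $ i $ 1 * B $ 1 $ j + A $ i $ 2 * B $ 2 $ j"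
  by (simp add: matrix_matrix_mult_def sum_2)

lemma mat_red_mult_left: "mat_red n (mat_red n A ** B) = mat_red n (A ** B)"
  unfolding vec_eq_iff mat_red_nth mult_nth_2 cong_def[symmetric]
  by (intro allI cong_add cong_mult) (simp_all add: cong_def)

lemma mat_red_mult_right: "mat_red n (A ** mat_red n B) = mat_red n (A ** B)"
  unfolding vec_eq_iff mat_red_nth mult_nth_2 cong_def[symmetric]
  by (intro allI cong_add cong_mult) (simp_all add: cong_def)

lemma carrier_M2: "n > 0 \<Longrightarrow> A \<in> carrier (M2 n) \<longleftrightarrow> mat_red n A = A"
proof -
  assume n: "n > 0"
  have "x \<in> carrier (residue_ring n) \<longleftrightarrow> x mod n = x" for x
    using n pos_mod_bound[OF n, of x] pos_mod_sign[OF n, of x]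
    by (auto simp: residue_ring_def mod_pos_pos_trivial simp del: pos_mod_bound pos_mod_sign)
  then show ?thesis by (simp add: M2_def vec_eq_iff)
qed

lemma det_mat_red: "[det (mat_red n A) = det A] (mod n)"
  unfolding det_2 mat_red_nth
  by (intro cong_diff cong_mult) (simp_all add: cong_def)

lemma monoid_M2:
  assumes "n > 0"
  shows "monoid (M2 n)"
proof -
  have idem: "mat_red n (mat_red n A) = mat_red n A" for A
    by (simp add: vec_eq_iff)
  show ?thesis
  proof (rule monoidI)
    fix x y z assume "x \<in> carrier (M2 n)" "y \<in> carrier (M2 n)" "z \<in> carrier (M2 n)"
    show "x \<otimes>\<^bsub>M2 n\<^esub> y \<in> carrier (M2 n)"
      unfolding carrier_M2[OF assms] by (simp add: M2_def idem)
    show "x \<otimes>\<^bsub>M2 n\<^esub> y \<otimes>\<^bsub>M2 n\<^esub> z = x \<otimes>\<^bsub>M2 n\<^esub> (y \<otimes>\<^bsub>M2 n\<^esub> z)"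
      by (simp add: M2_def mat_red_mult_left mat_red_mult_right matrix_mul_assoc)
  next
    show "\<one>\<^bsub>M2 n\<^esub> \<in> carrier (M2 n)"
      unfolding carrier_M2[OF assms] by (simp add: M2_def idem)
  next
    fix x assume x: "x \<in> carrier (M2 n)"
    then show "\<one>\<^bsub>M2 n\<^esub> \<otimes>\<^bsub>M2 n\<^esub> x = x" "x \<otimes>\<^bsub>M2 n\<^esub> \<one>\<^bsub>M2 n\<^esub> = x"
      unfolding carrier_M2[OF assms] by (simp_all add: M2_def mat_red_mult_left mat_red_mult_right)
  qed
qed

lemma group_GL2: "n > 0 \<Longrightarrow> group (GL2 n)"
  unfolding GL2_def by (intro monoid.units_group monoid_M2)

lemma det_mult_GL2: "[det (A \<otimes>\<^bsub>GL2 n\<^esub> B) = det A * det B] (mod n)"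
  using det_mat_red[of n "A ** B"] by (simp add: GL2_def units_of_def M2_def det_mul)

lemma det_one_GL2: "[det \<one>\<^bsub>GL2 n\<^esub> = 1] (mod n)"
  using det_mat_red[of n "mat 1"] by (simp add: GL2_def units_of_def M2_def)

lemma group_ESL2:
  assumes "n > 0"
  shows "group (ESL2 n)"
proof -
  interpret group "GL2 n" by (rule group_GL2[OF assms])
  let ?H = "{A \<in> carrier (GL2 n). [det A = 1] (mod n) \<or> [det A = -1] (mod n)}"
  have "subgroup ?H (GL2 n)"
  proof (rule subgroupI)
    show "?H \<subseteq> carrier (GL2 n)" by auto
    show "?H \<noteq> {}" using det_one_GL2[of n] by blast
  next
    fix A assume A: "A \<in> ?H"
    have "[det A * det (inv\<^bsub>GL2 n\<^esub> A) = 1] (mod n)"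
      using A det_mult_GL2[of n A "inv\<^bsub>GL2 n\<^esub> A"] det_one_GL2[of n]
      by (auto intro: cong_trans cong_sym)
    then have "[det (inv\<^bsub>GL2 n\<^esub> A) = 1] (mod n) \<or> [det (inv\<^bsub>GL2 n\<^esub> A) = -1] (mod n)"
    proof -
      consider "[det A = 1] (mod n)" | "[det A = -1] (mod n)" using A by auto
      then show ?thesis
      proof cases
        case 1
        then have "[det A * det (inv\<^bsub>GL2 n\<^esub> A) = 1 * det (inv\<^bsub>GL2 n\<^esub> A)] (mod n)"
          by (intro cong_mult cong_refl)
        with \<open>[det A * det (inv\<^bsub>GL2 n\<^esub> A) = 1] (mod n)\<close> show ?thesis
          by (auto simp: cong_def)
      next
        case 2
        then have "[det A * det (inv\<^bsub>GL2 n\<^esub> A) = -1 * det (inv\<^bsub>GL2 n\<^esub> A)] (mod n)"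
          by (intro cong_mult cong_refl)
        with \<open>[det A * det (inv\<^bsub>GL2 n\<^esub> A) = 1] (mod n)\<close>
        have "[- det (inv\<^bsub>GL2 n\<^esub> A) = - (-1)] (mod n)"
          by (auto simp: cong_def)
        then show ?thesis unfolding cong_minus_minus_iff by blast
      qed
    qed
    with A show "inv\<^bsub>GL2 n\<^esub> A \<in> ?H" by auto
  next
    fix A B assume AB: "A \<in> ?H" "B \<in> ?H"
    then obtain a b where ab: "a = 1 \<or> a = -1" "b = 1 \<or> b = -1"
      "[det A = a] (mod n)" "[det B = b] (mod n)" by blast
    have "[det (A \<otimes>\<^bsub>GL2 n\<^esub> B) = a * b] (mod n)"
      by (rule cong_trans[OF det_mult_GL2 cong_mult[OF ab(3,4)]])
    then show "A \<otimes>\<^bsub>GL2 n\<^esub> B \<in> ?H" using AB ab(1,2) by auto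
  qed
  then show ?thesis
    unfolding ESL2_def by (rule subgroup.subgroup_is_group) (rule is_group)
qed

end

theory Submission
  imports Defs "HOL-Algebra.Group_Action"
begin

text \<open>
  For a column vector \<open>v\<close>, the determinant of the matrix with columns \<open>v\<close> and \<open>A v\<close> is a binary
  quadratic form in \<open>v\<close> whose discriminant is \<open>(trace A)\<^sup>2 - 4 det A\<close>. Where this form takes a value
  \<open>\<plusminus> 1\<close> modulo \<open>n\<close>, that matrix conjugates \<open>A\<close> to the companion matrix of its characteristic
  polynomial. Modulo a prime not dividing the discriminant the form takes every value; modulo 3 it
  takes \<open>1\<close> or \<open>-1\<close> unless it vanishes identically, which fixes the sign; and Hensel lifting
  and the Chinese remainder theorem combine the local solutions. For determinant 1 and trace \<open>d - 1\<close>
  the discriminant is \<open>-3\<close> modulo \<open>dbar d\<close>, so 3 is the only prime that needs care. The form vanishes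
  modulo 3 exactly if \<open>A\<close> is scalar modulo 3. In that case 9 divides \<open>(trace A)\<^sup>2 - 4 det A\<close>, so 9 does
  not divide the modulus, and \<open>A\<close> is determined modulo 3 by its trace; a conjugation modulo the factor
  prime to 3 then extends to the whole modulus.
\<close>

section \<open>Values of binary quadratic forms modulo an integer\<close>

definition binary_form :: "int \<Rightarrow> int \<Rightarrow> int \<Rightarrow> int \<Rightarrow> int \<Rightarrow> int"
  where "binary_form a b c x y = a * x\<^sup>2 + b * x * y + c * y\<^sup>2"

definition binary_disc :: "int \<Rightarrow> int \<Rightarrow> int \<Rightarrow> int"
  where "binary_disc a b c = b\<^sup>2 - 4 * a * c"

definition represents_mod :: "int \<Rightarrow> int \<Rightarrow> int \<Rightarrow> int \<Rightarrow> int \<Rightarrow> bool"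
  where "represents_mod n a b c r \<longleftrightarrow> (\<exists>x y. [binary_form a b c x y = r] (mod n))"

lemma represents_modI: "[binary_form a b c x y = r] (mod n) \<Longrightarrow> represents_mod n a b c r"
  unfolding represents_mod_def by blast

lemma binary_form_cong:
  assumes "[x = x'] (mod n)" "[y = y'] (mod n)"
  shows "[binary_form a b c x y = binary_form a b c x' y'] (mod n)"
  unfolding binary_form_def by (intro cong_add cong_mult cong_pow cong_refl assms)

lemma binary_form_complete_square:
  "4 * a * binary_form a b c x y = (2 * a * x + b * y)\<^sup>2 - binary_disc a b c * y\<^sup>2"
  by (simp add: binary_form_def binary_disc_def power2_eq_square algebra_simps)

lemma binary_form_add:
  "binary_form a b c (x + h) (y + k) =
    binary_form a b c x y + ((2 * a * x + b * y) * h + (b * x + 2 * c * y) * k) + binary_form a b c h k"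
  by (simp add: binary_form_def power2_eq_square algebra_simps)

lemma binary_form_scale: "binary_form a b c (m * x) (m * y) = m\<^sup>2 * binary_form a b c x y"
  by (simp add: binary_form_def power2_eq_square algebra_simps)

lemma binary_form_Euler:
  "x * (2 * a * x + b * y) + y * (b * x + 2 * c * y) = 2 * binary_form a b c x y"
  by (simp add: binary_form_def power2_eq_square algebra_simps)

lemma represents_mod_swap: "represents_mod n a b c r \<longleftrightarrow> represents_mod n c b a r"
proof -
  have "binary_form a b c x y = binary_form c b a y x" for x y
    by (simp add: binary_form_def)
  then show ?thesis unfolding represents_mod_def by metis
qed

lemma cong_solve_prime_int:
  fixes p :: int
  assumes "prime p" "\<not> p dvd u"
  shows "\<exists>x. [u * x = k] (mod p)"
proof -
  have "gcd u p = 1" using prime_imp_coprime[OF assms] by (simp add: gcd.commute)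
  then show ?thesis by (intro cong_solve_dvd_int) simp
qed

lemma prime_dvd_2_iff: "prime p \<Longrightarrow> p dvd 2 \<longleftrightarrow> p = 2" for p :: int
  using primes_dvd_imp_eq[of p 2] by auto

lemma inj_on_affine_square_mod_prime:
  fixes p :: int
  assumes p: "prime p" and D: "\<not> p dvd D"
  shows "inj_on (\<lambda>x. (D * x\<^sup>2 + R) mod p) {0..(p - 1) div 2}"
proof (rule inj_onI)
  fix x y
  assume x: "x \<in> {0..(p - 1) div 2}" and y: "y \<in> {0..(p - 1) div 2}"
    and eq: "(D * x\<^sup>2 + R) mod p = (D * y\<^sup>2 + R) mod p"
  from eq have "p dvd D * ((x - y) * (x + y))"
    by (simp add: mod_eq_dvd_iff algebra_simps power2_eq_square)
  then consider (diff) "p dvd x - y" | (sum) "p dvd x + y"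
    using p D by (auto simp: prime_dvd_mult_iff)
  then show "x = y"
  proof cases
    case diff
    moreover have "\<bar>x - y\<bar> < p" using x y prime_gt_1_int[OF p] by auto
    ultimately show ?thesis using dvd_imp_le_int[of "x - y" p] by force
  next
    case sum
    moreover have "\<bar>x + y\<bar> < p" using x y prime_gt_1_int[OF p] by auto
    ultimately have "x + y = 0" using dvd_imp_le_int[of "x + y" p] by force
    then show ?thesis using x y by simp
  qed
qed

lemma ex_square_minus_mult_square_cong_mod_odd_prime:
  fixes p :: int
  assumes p: "prime p" "odd p" and D: "\<not> p dvd D"
  shows "\<exists>x y. [x\<^sup>2 - D * y\<^sup>2 = R] (mod p)"
proof -
  let ?I = "{0..(p - 1) div 2}"
  define X where "X = (\<lambda>x. (1 * x\<^sup>2 + 0) mod p) ` ?I"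
  define Y where "Y = (\<lambda>y. (D * y\<^sup>2 + R) mod p) ` ?I"
  have p_gt_1: "p > 1" using p(1) by (rule prime_gt_1_int)
  have card_X: "card X = card ?I" unfolding X_def
    using not_prime_unit p(1) by (intro card_image inj_on_affine_square_mod_prime) auto
  have card_Y: "card Y = card ?I" unfolding Y_def
    by (intro card_image inj_on_affine_square_mod_prime p D)
  have card_I: "2 * card ?I = nat p + 1" using p p_gt_1 by (auto elim!: oddE)
  have "X \<union> Y \<subseteq> {0..<p}" using p_gt_1 by (auto simp: X_def Y_def)
  then have "card (X \<union> Y) \<le> nat p" using card_mono[of "{0..<p}"] by fastforce
  moreover have "finite X" "finite Y" by (simp_all add: X_def Y_def)
  ultimately have "X \<inter> Y \<noteq> {}" using card_Un_disjoint[of X Y] card_X card_Y card_I by auto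
  then obtain x y where "x\<^sup>2 mod p = (D * y\<^sup>2 + R) mod p" by (auto simp: X_def Y_def)
  then have "[x\<^sup>2 - D * y\<^sup>2 = R] (mod p)" by (simp add: cong_def mod_eq_dvd_iff algebra_simps)
  then show ?thesis by blast
qed

lemma represents_mod_odd_prime_if_unit_lead:
  assumes p: "prime p" "odd p" and disc: "\<not> p dvd binary_disc a b c" and a: "\<not> p dvd a"
  shows "represents_mod p a b c r"
proof -
  have not_dvd_2a: "\<not> p dvd 2 * a" using p a by (auto simp: prime_dvd_mult_iff prime_dvd_2_iff)
  then have not_dvd_4a: "\<not> p dvd 4 * a"
    using p(1) prime_dvd_mult_iff[of p 2 "2 * a"] prime_dvd_mult_iff[of p 2 a] by simp
  obtain s y where sy: "[s\<^sup>2 - binary_disc a b c * y\<^sup>2 = 4 * a * r] (mod p)"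
    using ex_square_minus_mult_square_cong_mod_odd_prime[OF p disc] by blast
  obtain x where x: "[2 * a * x = s - b * y] (mod p)"
    using cong_solve_prime_int[OF p(1) not_dvd_2a] by blast
  have "[2 * a * x + b * y = s] (mod p)"
    using cong_add[OF x cong_refl[of "b * y"]] by simp
  then have "[4 * a * binary_form a b c x y = s\<^sup>2 - binary_disc a b c * y\<^sup>2] (mod p)"
    unfolding binary_form_complete_square by (intro cong_diff cong_pow cong_refl)
  then have "[4 * a * binary_form a b c x y = 4 * a * r] (mod p)"
    using sy by (rule cong_trans)
  moreover have "coprime (4 * a) p"
    using prime_imp_coprime[OF p(1) not_dvd_4a] by (simp add: coprime_commute)
  ultimately show ?thesis by (auto simp: cong_mult_lcancel intro: represents_modI)
qed

lemma represents_mod_2: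
  assumes "odd b"
  shows "represents_mod 2 a b c r"
proof (cases "even r")
  case True
  then have "[binary_form a b c 0 0 = r] (mod 2)"
    by (simp add: binary_form_def cong_iff_dvd_diff)
  then show ?thesis by (rule represents_modI)
next
  case False
  have "odd (binary_form a b c 1 0) \<or> odd (binary_form a b c 0 1) \<or> odd (binary_form a b c 1 1)"
    using assms by (auto simp: binary_form_def)
  then obtain x y where "odd (binary_form a b c x y)" by blast
  with False have "[binary_form a b c x y = r] (mod 2)" by (simp add: cong_iff_dvd_diff)
  then show ?thesis by (rule represents_modI)
qed

lemma represents_mod_prime:
  assumes p: "prime p" and disc: "\<not> p dvd binary_disc a b c"
  shows "represents_mod p a b c r"
proof (cases "p = 2")
  case True
  with disc show ?thesis by (auto simp: binary_disc_def intro: represents_mod_2)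
next
  case False
  then have odd: "odd p" using primes_dvd_imp_eq[OF two_is_prime p] by auto
  consider (unit_a) "\<not> p dvd a" | (unit_c) "\<not> p dvd c" | (vanishing) "p dvd a" "p dvd c" by blast
  then show ?thesis
  proof cases
    case unit_a
    then show ?thesis by (rule represents_mod_odd_prime_if_unit_lead[OF p odd disc])
  next
    case unit_c
    have "\<not> p dvd binary_disc c b a" using disc by (simp add: binary_disc_def mult_ac)
    then show ?thesis
      unfolding represents_mod_swap[of p a] using unit_c by (rule represents_mod_odd_prime_if_unit_lead[OF p odd])
  next
    case vanishing
    then have "\<not> p dvd b" using disc by (auto simp: binary_disc_def power2_eq_square)
    then obtain x where x: "[b * x = r] (mod p)" using cong_solve_prime_int p by blast
    have "[a * x\<^sup>2 + b * x + c = 0 * x\<^sup>2 + r + 0] (mod p)"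
      using vanishing x by (intro cong_add cong_mult cong_refl) (auto simp: cong_0_iff)
    then have "[binary_form a b c x 1 = r] (mod p)" by (simp add: binary_form_def)
    then show ?thesis by (rule represents_modI)
  qed
qed

lemma binary_form_gradient_not_dvd:
  assumes p: "prime p" and b: "p = 2 \<Longrightarrow> odd b" and f: "\<not> p dvd binary_form a b c x y"
  shows "\<not> p dvd 2 * a * x + b * y \<or> \<not> p dvd b * x + 2 * c * y"
proof (rule ccontr)
  assume "\<not> ?thesis"
  then have grad: "p dvd 2 * a * x + b * y" "p dvd b * x + 2 * c * y" by auto
  show False
  proof (cases "p = 2")
    case True
    with grad b have "even x" "even y" by auto
    with f True show False by (auto simp: binary_form_def)
  next
    case False
    have "p dvd 2 * binary_form a b c x y"
      unfolding binary_form_Euler[symmetric] using grad by simp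
    then have "p dvd 2" using f p by (simp add: prime_dvd_mult_iff)
    with False p show False by (simp add: prime_dvd_2_iff)
  qed
qed

lemma represents_mod_lift:
  assumes p: "prime p" and pm: "p dvd m" and r: "\<not> p dvd r" and b: "p = 2 \<Longrightarrow> odd b"
    and m: "represents_mod m a b c r"
  shows "represents_mod (p * m) a b c r"
proof -
  obtain x y where f: "[binary_form a b c x y = r] (mod m)"
    using m unfolding represents_mod_def by blast
  define u v where "u = 2 * a * x + b * y" and "v = b * x + 2 * c * y"
  have "\<not> p dvd binary_form a b c x y"
    using cong_dvd_iff[OF cong_dvd_modulus[OF f pm]] r by blast
  then have uv: "\<not> p dvd u \<or> \<not> p dvd v"
    using binary_form_gradient_not_dvd[OF p] b unfolding u_def v_def by blast
  obtain k where k: "binary_form a b c x y - r = m * k"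
    using f unfolding cong_iff_dvd_diff by blast
  obtain s t where st: "[u * s + v * t = - k] (mod p)"
  proof (cases "p dvd u")
    case True
    then obtain t where "[v * t = - k] (mod p)" using cong_solve_prime_int[OF p] uv by blast
    then show ?thesis using that[of 0 t] by simp
  next
    case False
    then obtain s where "[u * s = - k] (mod p)" using cong_solve_prime_int[OF p] by blast
    then show ?thesis using that[of s 0] by simp
  qed
  have "binary_form a b c (x + m * s) (y + m * t) - r
      = m * (u * s + v * t + k) + m\<^sup>2 * binary_form a b c s t"
    unfolding binary_form_add binary_form_scale u_def[symmetric] v_def[symmetric]
    using k by (simp add: algebra_simps)
  moreover have "p * m dvd m * (u * s + v * t + k)"
    using st unfolding cong_iff_dvd_diff by (simp add: mult.commute[of p])
  moreover have "p * m dvd m\<^sup>2 * binary_form a b c s t"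
    using pm by (simp add: power2_eq_square mult_dvd_mono)
  ultimately have "[binary_form a b c (x + m * s) (y + m * t) = r] (mod p * m)"
    unfolding cong_iff_dvd_diff by simp
  then show ?thesis by (rule represents_modI)
qed

lemma represents_mod_coprime_mult:
  assumes cop: "coprime k m" and k: "represents_mod k a b c r" and m: "represents_mod m a b c r"
  shows "represents_mod (k * m) a b c r"
proof -
  obtain x y where xy: "[binary_form a b c x y = r] (mod k)"
    using k unfolding represents_mod_def by blast
  obtain x' y' where xy': "[binary_form a b c x' y' = r] (mod m)"
    using m unfolding represents_mod_def by blast
  obtain X where X: "[X = x] (mod k)" "[X = x'] (mod m)"
    using binary_chinese_remainder_int[OF cop] by blast
  obtain Y where Y: "[Y = y] (mod k)" "[Y = y'] (mod m)"
    using binary_chinese_remainder_int[OF cop] by blast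
  have "[binary_form a b c X Y = r] (mod k)" "[binary_form a b c X Y = r] (mod m)"
    using binary_form_cong[OF X(1) Y(1)] xy binary_form_cong[OF X(2) Y(2)] xy'
    by (blast intro: cong_trans)+
  then have "[binary_form a b c X Y = r] (mod k * m)" using cop by (rule coprime_cong_mult)
  then show ?thesis by (rule represents_modI)
qed

lemma represents_mod_if_represents_mod_primes:
  fixes n :: int
  assumes "n \<noteq> 0" "coprime r n" "even n \<Longrightarrow> odd b"
    and "\<And>p. prime p \<Longrightarrow> p dvd n \<Longrightarrow> represents_mod p a b c r"
  shows "represents_mod n a b c r"
  using assms
proof (induction n rule: prime_divisors_induct)
  case zero
  then show ?case by simp
next
  case (unit n)
  then have "[binary_form a b c 0 0 = r] (mod n)" by (simp add: cong_iff_dvd_diff unit_imp_dvd)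
  then show ?case by (rule represents_modI)
next
  case (factor p m)
  have m: "represents_mod m a b c r" using factor.prems by (intro factor.IH) auto
  show ?case
  proof (cases "p dvd m")
    case True
    have "\<not> p dvd r"
      using factor.hyps factor.prems(2) coprime_common_divisor[of r p p] not_prime_unit by auto
    then show ?thesis
      using factor.prems(3) by (intro represents_mod_lift[OF factor.hyps True _ _ m]) auto
  next
    case False
    then have "coprime p m" using factor.hyps by (intro prime_imp_coprime)
    then show ?thesis
      using factor.prems(4) factor.hyps m by (intro represents_mod_coprime_mult) auto
  qed
qed

lemma represents_pm1_mod_3:
  assumes "\<not> (3 dvd a \<and> 3 dvd b \<and> 3 dvd c)"
  shows "\<exists>r\<in>{1, -1}. represents_mod 3 a b c r"
proof -
  have "\<not> (3 dvd binary_form a b c 1 0 \<and> 3 dvd binary_form a b c 0 1 \<and> 3 dvd binary_form a b c 1 1)"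
    using assms unfolding binary_form_def by simp presburger
  then obtain x y where xy: "\<not> 3 dvd binary_form a b c x y" by blast
  have "[z = 1] (mod 3) \<or> [z = -1] (mod 3)" if "\<not> 3 dvd z" for z :: int
    using that unfolding cong_iff_dvd_diff by presburger
  from this[OF xy] show ?thesis by (auto intro: represents_modI)
qed

lemma represents_pm1_mod:
  assumes n: "n \<noteq> 0" and disc: "prime_factors (gcd n (binary_disc a b c)) \<subseteq> {3}"
    and not_dvd: "3 dvd n \<Longrightarrow> \<not> (3 dvd a \<and> 3 dvd b \<and> 3 dvd c)"
  shows "\<exists>r\<in>{1, -1}. represents_mod n a b c r"
proof -
  have not_dvd_disc: "\<not> p dvd binary_disc a b c" if "prime p" "p dvd n" "p \<noteq> 3" for p
    using that n disc by (auto simp: in_prime_factors_iff)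
  obtain r :: int where r: "r \<in> {1, -1}" and rep_3: "3 dvd n \<Longrightarrow> represents_mod 3 a b c r"
    using represents_pm1_mod_3 not_dvd by (cases "3 dvd n") blast+
  have "represents_mod n a b c r"
  proof (rule represents_mod_if_represents_mod_primes[OF n])
    show "coprime r n" using r by auto
    show "odd b" if "even n" using not_dvd_disc[of 2] that by (auto simp: binary_disc_def)
    show "represents_mod p a b c r" if "prime p" "p dvd n" for p
      using that rep_3 not_dvd_disc represents_mod_prime by (cases "p = 3") auto
  qed
  with r show ?thesis ..
qed

section \<open>Matrices modulo an integer\<close>

lemma mat2_nth [simp]:
  "mat2 a b c e $ 1 $ 1 = a" "mat2 a b c e $ 1 $ 2 = b"
  "mat2 a b c e $ 2 $ 1 = c" "mat2 a b c e $ 2 $ 2 = e"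
  by (simp_all add: mat2_def)

lemma trace_2: "trace (A :: int^2^2) = A $ 1 $ 1 + A $ 2 $ 2"
  by (simp add: trace_def sum_2)

lemma mat_mult_commute: "mat c ** A = A ** mat c" for A :: "int^2^2"
  by (simp add: vec_eq_iff forall_2 mult_nth_2 mat_def)

lemma mat_red_eq_iff: "mat_red n A = mat_red n B \<longleftrightarrow> (\<forall>i j. [A $ i $ j = B $ i $ j] (mod n))"
  by (simp add: vec_eq_iff cong_def)

lemma mat_red_dvd: "m dvd n \<Longrightarrow> mat_red m (mat_red n A) = mat_red m A"
  by (simp add: vec_eq_iff mod_mod_cancel)

lemma mat_red_mult_cong:
  assumes "mat_red n A = mat_red n A'" "mat_red n B = mat_red n B'"
  shows "mat_red n (A ** B) = mat_red n (A' ** B')"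
  using assms by (metis mat_red_mult_left mat_red_mult_right)

lemma det_cong_mat_red:
  assumes "mat_red n A = mat_red n B"
  shows "[det A = det B] (mod n)"
  using det_mat_red[of n A] det_mat_red[of n B] assms by (metis cong_sym cong_trans)

lemma trace_mat_red: "[trace (mat_red n A) = trace A] (mod n)"
  unfolding trace_2 mat_red_nth by (intro cong_add) (simp_all add: cong_def)

lemma trace_cong_mat_red:
  assumes "mat_red n A = mat_red n B"
  shows "[trace A = trace B] (mod n)"
  using trace_mat_red[of n A] trace_mat_red[of n B] assms by (metis cong_sym cong_trans)

lemma mat_red_coprime_mult:
  assumes "coprime k m" "mat_red k A = mat_red k B" "mat_red m A = mat_red m B"
  shows "mat_red (k * m) A = mat_red (k * m) B"
  using assms by (auto simp: mat_red_eq_iff intro: coprime_cong_mult)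

lemma mat_red_chinese_remainder:
  assumes "coprime k m"
  shows "\<exists>X. mat_red k X = mat_red k A \<and> mat_red m X = mat_red m B"
proof -
  have "\<forall>i j. \<exists>x. [x = A $ i $ j] (mod k) \<and> [x = B $ i $ j] (mod m)"
    using binary_chinese_remainder_int[OF assms] by blast
  then obtain f where "\<forall>i j. [f i j = A $ i $ j] (mod k) \<and> [f i j = B $ i $ j] (mod m)"
    by metis
  then show ?thesis by (intro exI[of _ "\<chi> i j. f i j"]) (simp add: mat_red_eq_iff)
qed

definition scalar_mod :: "int \<Rightarrow> int^2^2 \<Rightarrow> bool"
  where "scalar_mod k A \<longleftrightarrow> (\<exists>c. mat_red k A = mat_red k (mat c))"

lemma scalar_mod_iff:
  "scalar_mod k A \<longleftrightarrow> k dvd A $ 1 $ 2 \<and> k dvd A $ 2 $ 1 \<and> k dvd A $ 2 $ 2 - A $ 1 $ 1"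
proof
  assume "scalar_mod k A"
  then obtain c where diag: "[A $ 2 $ 2 = c] (mod k)" "[A $ 1 $ 1 = c] (mod k)"
    and off_diag: "k dvd A $ 1 $ 2" "k dvd A $ 2 $ 1"
    by (auto simp: scalar_mod_def mat_red_eq_iff forall_2 mat_def cong_0_iff)
  have "[A $ 2 $ 2 = A $ 1 $ 1] (mod k)" using cong_trans[OF diag(1) cong_sym[OF diag(2)]] .
  with off_diag show "k dvd A $ 1 $ 2 \<and> k dvd A $ 2 $ 1 \<and> k dvd A $ 2 $ 2 - A $ 1 $ 1"
    by (simp add: cong_iff_dvd_diff)
next
  assume "k dvd A $ 1 $ 2 \<and> k dvd A $ 2 $ 1 \<and> k dvd A $ 2 $ 2 - A $ 1 $ 1"
  then have "mat_red k A = mat_red k (mat (A $ 1 $ 1))"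
    by (simp add: mat_red_eq_iff forall_2 mat_def cong_iff_dvd_diff)
  then show "scalar_mod k A" unfolding scalar_mod_def ..
qed

lemma scalar_mod_mat_red:
  assumes "k dvd n"
  shows "scalar_mod k (mat_red n A) \<longleftrightarrow> scalar_mod k A"
  unfolding scalar_mod_def mat_red_dvd[OF assms] ..

lemma mat_red_eq_if_scalar_mod:
  assumes "odd k" "scalar_mod k A" "scalar_mod k B" and tr: "[trace A = trace B] (mod k)"
  shows "mat_red k A = mat_red k B"
proof -
  obtain a b where a: "mat_red k A = mat_red k (mat a)" and b: "mat_red k B = mat_red k (mat b)"
    using assms(2,3) unfolding scalar_mod_def by blast
  have "[2 * a = 2 * b] (mod k)"
    using trace_cong_mat_red[OF a] trace_cong_mat_red[OF b] tr
    by (simp add: trace_2 mat_def) (metis cong_sym cong_trans)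
  then have "[a = b] (mod k)" using \<open>odd k\<close> by (simp add: cong_mult_lcancel)
  then show ?thesis unfolding a b by (simp add: mat_red_eq_iff mat_def)
qed

lemma square_dvd_char_disc_if_scalar_mod:
  assumes "scalar_mod k A"
  shows "k\<^sup>2 dvd (trace A)\<^sup>2 - 4 * det A"
proof -
  have "(trace A)\<^sup>2 - 4 * det A = (A $ 2 $ 2 - A $ 1 $ 1)\<^sup>2 + 4 * (A $ 1 $ 2 * A $ 2 $ 1)"
    by (simp add: trace_2 det_2 power2_eq_square algebra_simps)
  also have "k\<^sup>2 dvd \<dots>"
    using assms unfolding scalar_mod_iff power2_eq_square
    by (intro dvd_add dvd_mult[of _ _ 4] mult_dvd_mono) auto
  finally show ?thesis .
qed

definition companion_mat :: "int \<Rightarrow> int \<Rightarrow> int^2^2"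
  where "companion_mat t \<delta> = mat2 0 (- \<delta>) 1 t"

definition krylov_mat :: "int^2^2 \<Rightarrow> int^2 \<Rightarrow> int^2^2"
  where "krylov_mat A v = (\<chi> i j. if j = 1 then v $ i else (A *v v) $ i)"

lemma matrix_vector_mult_2:
  "(A *v v) $ i = A $ i $ 1 * v $ 1 + A $ i $ 2 * v $ 2" for A :: "int^2^2"
  by (simp add: matrix_vector_mult_def sum_2)

lemma mult_krylov_mat: "A ** krylov_mat A v = krylov_mat A v ** companion_mat (trace A) (det A)"
  by (simp add: vec_eq_iff forall_2 mult_nth_2 krylov_mat_def companion_mat_def
      matrix_vector_mult_2 trace_2 det_2 algebra_simps)

lemma det_krylov_mat:
  "det (krylov_mat A v)
    = binary_form (A $ 2 $ 1) (A $ 2 $ 2 - A $ 1 $ 1) (- A $ 1 $ 2) (v $ 1) (v $ 2)"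
  by (simp add: det_2 krylov_mat_def matrix_vector_mult_2 binary_form_def power2_eq_square algebra_simps)

lemma binary_disc_char_disc:
  "binary_disc (A $ 2 $ 1) (A $ 2 $ 2 - A $ 1 $ 1) (- A $ 1 $ 2) = (trace A)\<^sup>2 - 4 * det A"
  for A :: "int^2^2"
  by (simp add: binary_disc_def trace_2 det_2 power2_eq_square algebra_simps)

lemma companion_mat_cong:
  assumes "[t = t'] (mod n)" "[\<delta> = \<delta>'] (mod n)"
  shows "mat_red n (companion_mat t \<delta>) = mat_red n (companion_mat t' \<delta>')"
  using assms by (simp add: mat_red_eq_iff forall_2 companion_mat_def cong_minus_minus_iff)

section \<open>Conjugacy classes\<close>

lemma (in group) conjugacy_class_eq_orbit:
  assumes "x \<in> carrier G"
  shows "conjugacy_class G x = orbit G (\<lambda>g. \<lambda>h\<in>carrier G. g \<otimes> h \<otimes> inv g) x"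
  using assms by (simp add: conjugacy_class_def orbit_def)

lemma (in group) mem_conjugacy_class_iff:
  assumes "x \<in> carrier G" "y \<in> carrier G"
  shows "y \<in> conjugacy_class G x \<longleftrightarrow> (\<exists>g\<in>carrier G. y \<otimes> g = g \<otimes> x)"
proof -
  have "y = g \<otimes> x \<otimes> inv g \<longleftrightarrow> y \<otimes> g = g \<otimes> x" if "g \<in> carrier G" for g
    using that assms by (metis inv_solve_right m_closed)
  then show ?thesis unfolding conjugacy_class_def by blast
qed

lemma (in group) conjugacy_class_sym:
  assumes "x \<in> carrier G" "y \<in> carrier G" "y \<in> conjugacy_class G x"
  shows "x \<in> conjugacy_class G y"
  using group_action.orbit_sym[OF action_by_conjugation] assms by (simp add: conjugacy_class_eq_orbit)

lemma (in group) conjugacy_class_trans: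
  assumes "x \<in> carrier G" "y \<in> carrier G" "z \<in> carrier G"
    and "y \<in> conjugacy_class G x" "z \<in> conjugacy_class G y"
  shows "z \<in> conjugacy_class G x"
  using group_action.orbit_trans[OF action_by_conjugation, of x y z] assms
  by (simp add: conjugacy_class_eq_orbit)

lemma ESL2_mult: "A \<otimes>\<^bsub>ESL2 n\<^esub> B = mat_red n (A ** B)"
  by (simp add: ESL2_def GL2_def units_of_def M2_def)

lemma ESL2_one: "\<one>\<^bsub>ESL2 n\<^esub> = mat_red n (mat 1)"
  by (simp add: ESL2_def GL2_def units_of_def M2_def)

lemma mat_red_ESL2: "n > 0 \<Longrightarrow> A \<in> carrier (ESL2 n) \<Longrightarrow> mat_red n A = A"
  using carrier_M2[of n A] by (auto simp: ESL2_def GL2_def units_of_def Units_def)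

lemma mat_red_in_ESL2_iff:
  assumes n: "n > 0"
  shows "mat_red n A \<in> carrier (ESL2 n) \<longleftrightarrow> (\<exists>r\<in>{1, -1}. [det A = r] (mod n))"
proof
  assume "mat_red n A \<in> carrier (ESL2 n)"
  then have "\<exists>r\<in>{1, -1}. [det (mat_red n A) = r] (mod n)" by (auto simp: ESL2_def)
  then show "\<exists>r\<in>{1, -1}. [det A = r] (mod n)"
    using cong_sym[OF det_mat_red] by (blast intro: cong_trans)
next
  assume "\<exists>r\<in>{1, -1}. [det A = r] (mod n)"
  then obtain r where r: "r \<in> {1, -1}" "[det A = r] (mod n)" ..
  define B where "B = mat2 (r * A $ 2 $ 2) (- r * A $ 1 $ 2) (- r * A $ 2 $ 1) (r * A $ 1 $ 1)"
  have "[r * det A = 1] (mod n)"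
    using cong_mult[OF cong_refl[of r] r(2)] r(1) by auto
  then have "mat_red n (A ** B) = mat_red n (mat 1)" "mat_red n (B ** A) = mat_red n (mat 1)"
    by (auto simp: mat_red_eq_iff forall_2 mult_nth_2 B_def mat_def det_2 algebra_simps)
  then have "mat_red n A \<in> Units (M2 n)"
    unfolding Units_def using carrier_M2[OF n] mat_red_dvd[of n n]
    by (auto simp: M2_def mat_red_mult_left mat_red_mult_right intro!: exI[of _ "mat_red n B"])
  moreover have "[det (mat_red n A) = r] (mod n)"
    using det_mat_red r(2) by (rule cong_trans)
  ultimately show "mat_red n A \<in> carrier (ESL2 n)"
    using r(1) by (auto simp: ESL2_def GL2_def units_of_def)
qed

lemma mat_red_in_ESL2_dvd:
  assumes m: "m > 0" "m dvd n" and A: "A \<in> carrier (ESL2 n)"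
  shows "mat_red m A \<in> carrier (ESL2 m)"
proof -
  have "\<exists>r\<in>{1, -1}. [det A = r] (mod n)" using A by (auto simp: ESL2_def)
  then show ?thesis
    unfolding mat_red_in_ESL2_iff[OF m(1)] using m(2) cong_dvd_modulus by blast
qed

lemma mem_conjugacy_class_ESL2_iff:
  assumes n: "n > 0" and A: "mat_red n A \<in> carrier (ESL2 n)" and B: "mat_red n B \<in> carrier (ESL2 n)"
  shows "mat_red n A \<in> conjugacy_class (ESL2 n) (mat_red n B) \<longleftrightarrow>
    (\<exists>g. mat_red n g \<in> carrier (ESL2 n) \<and> mat_red n (A ** g) = mat_red n (g ** B))"
proof -
  interpret group "ESL2 n" by (rule group_ESL2[OF n])
  have "mat_red n A \<in> conjugacy_class (ESL2 n) (mat_red n B) \<longleftrightarrow>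
      (\<exists>g\<in>carrier (ESL2 n). mat_red n (A ** g) = mat_red n (g ** B))"
    unfolding mem_conjugacy_class_iff[OF B A] ESL2_mult mat_red_mult_left mat_red_mult_right ..
  also have "\<dots> \<longleftrightarrow> (\<exists>g. mat_red n g \<in> carrier (ESL2 n) \<and> mat_red n (A ** g) = mat_red n (g ** B))"
    using mat_red_ESL2[OF n] by (metis mat_red_mult_left mat_red_mult_right)
  finally show ?thesis .
qed

lemma conjugacy_class_ESL2E:
  assumes n: "n > 0" and B: "B \<in> carrier (ESL2 n)" and A: "A \<in> conjugacy_class (ESL2 n) B"
  obtains g h where "A = mat_red n (g ** B ** h)"
    "mat_red n (g ** h) = mat_red n (mat 1)" "mat_red n (h ** g) = mat_red n (mat 1)"
proof -
  interpret group "ESL2 n" by (rule group_ESL2[OF n])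
  obtain g where g: "g \<in> carrier (ESL2 n)"
    and "A = g \<otimes>\<^bsub>ESL2 n\<^esub> B \<otimes>\<^bsub>ESL2 n\<^esub> inv\<^bsub>ESL2 n\<^esub> g"
    using A by (auto simp: conjugacy_class_def)
  then have "A = mat_red n (g ** B ** inv\<^bsub>ESL2 n\<^esub> g)"
    by (simp add: ESL2_mult mat_red_mult_left)
  moreover have "mat_red n (g ** inv\<^bsub>ESL2 n\<^esub> g) = mat_red n (mat 1)"
      "mat_red n (inv\<^bsub>ESL2 n\<^esub> g ** g) = mat_red n (mat 1)"
    using r_inv[OF g] l_inv[OF g] by (simp_all add: ESL2_mult ESL2_one)
  ultimately show ?thesis using that by blast
qed

lemma det_conjugate_ESL2:
  assumes "n > 0" "B \<in> carrier (ESL2 n)" "A \<in> conjugacy_class (ESL2 n) B"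
  shows "[det A = det B] (mod n)"
  using assms
proof (rule conjugacy_class_ESL2E)
  fix g h
  assume A: "A = mat_red n (g ** B ** h)" and gh: "mat_red n (g ** h) = mat_red n (mat 1)"
  have "[det A = det (g ** B ** h)] (mod n)" unfolding A by (rule det_mat_red)
  also have "det (g ** B ** h) = det B * det (g ** h)" by (simp add: det_mul)
  also have "[det B * det (g ** h) = det B * det (mat 1 :: int^2^2)] (mod n)"
    by (intro cong_mult cong_refl det_cong_mat_red gh)
  finally show ?thesis by simp
qed

lemma trace_conjugate_ESL2:
  assumes "n > 0" "B \<in> carrier (ESL2 n)" "A \<in> conjugacy_class (ESL2 n) B"
  shows "[trace A = trace B] (mod n)"
  using assms
proof (rule conjugacy_class_ESL2E)
  fix g h
  assume A: "A = mat_red n (g ** B ** h)" and hg: "mat_red n (h ** g) = mat_red n (mat 1)"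
  have "[trace A = trace (g ** B ** h)] (mod n)" unfolding A by (rule trace_mat_red)
  also have "trace (g ** B ** h) = trace (h ** g ** B)"
    by (metis matrix_mul_assoc trace_mul_sym)
  also have "[trace (h ** g ** B) = trace (mat 1 ** B)] (mod n)"
    by (intro trace_cong_mat_red mat_red_mult_cong hg refl)
  finally show ?thesis by simp
qed

lemma scalar_mod_conjugate_ESL2:
  assumes "n > 0" "B \<in> carrier (ESL2 n)" "A \<in> conjugacy_class (ESL2 n) B"
    and "k dvd n" and "scalar_mod k B"
  shows "scalar_mod k A"
proof -
  obtain c where c: "mat_red k B = mat_red k (mat c)"
    using \<open>scalar_mod k B\<close> unfolding scalar_mod_def ..
  obtain g h where A: "A = mat_red n (g ** B ** h)" and gh: "mat_red n (g ** h) = mat_red n (mat 1)"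
    using conjugacy_class_ESL2E[OF assms(1-3)] by metis
  have "mat_red k A = mat_red k (g ** B ** h)"
    by (simp add: A mat_red_dvd \<open>k dvd n\<close>)
  also have "\<dots> = mat_red k (g ** mat c ** h)"
    by (intro mat_red_mult_cong c refl)
  also have "g ** mat c ** h = mat c ** (g ** h)"
    by (simp add: mat_mult_commute[symmetric] matrix_mul_assoc)
  also have "mat_red k (mat c ** (g ** h)) = mat_red k (mat c ** mat 1)"
    using arg_cong[OF gh, of "mat_red k"] \<open>k dvd n\<close>
    by (intro mat_red_mult_cong) (simp_all add: mat_red_dvd)
  finally show ?thesis unfolding scalar_mod_def by auto
qed

lemma mat_red_ESL2_surj:
  assumes pos: "k > 0" "m > 0" and cop: "coprime k m" and g: "mat_red m g \<in> carrier (ESL2 m)"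
  obtains X where "mat_red (k * m) X \<in> carrier (ESL2 (k * m))" "mat_red m X = mat_red m g"
proof -
  obtain r where r: "r \<in> {1, -1}" "[det g = r] (mod m)"
    using g mat_red_in_ESL2_iff[OF pos(2)] by blast
  obtain X where Xk: "mat_red k X = mat_red k (mat2 r 0 0 1)" and Xm: "mat_red m X = mat_red m g"
    using mat_red_chinese_remainder[OF cop] by blast
  have "[det X = r] (mod k)" using det_cong_mat_red[OF Xk] by (simp add: det_2)
  moreover have "[det X = r] (mod m)" using det_cong_mat_red[OF Xm] r(2) by (rule cong_trans)
  ultimately have "[det X = r] (mod k * m)" using cop by (rule coprime_cong_mult)
  then have "mat_red (k * m) X \<in> carrier (ESL2 (k * m))"
    using mat_red_in_ESL2_iff[of "k * m"] pos r(1) by auto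
  then show ?thesis using Xm by (rule that)
qed

lemma conjugate_ESL2_coprime_mult:
  assumes pos: "k > 0" "m > 0" and cop: "coprime k m"
    and A: "A \<in> carrier (ESL2 (k * m))" and B: "B \<in> carrier (ESL2 (k * m))"
    and k: "scalar_mod k B" "mat_red k A = mat_red k B"
    and m: "mat_red m A \<in> conjugacy_class (ESL2 m) (mat_red m B)"
  shows "A \<in> conjugacy_class (ESL2 (k * m)) B"
proof -
  have km: "k * m > 0" using pos by simp
  have "mat_red m A \<in> carrier (ESL2 m)" "mat_red m B \<in> carrier (ESL2 m)"
    using mat_red_in_ESL2_dvd[OF pos(2) dvd_triv_right] A B by blast+
  then obtain g where "mat_red m g \<in> carrier (ESL2 m)" and g: "mat_red m (A ** g) = mat_red m (g ** B)"
    using m mem_conjugacy_class_ESL2_iff[OF pos(2)] by blast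
  then obtain X where X: "mat_red (k * m) X \<in> carrier (ESL2 (k * m))" "mat_red m X = mat_red m g"
    using mat_red_ESL2_surj[OF pos cop] by blast
  obtain c where c: "mat_red k B = mat_red k (mat c)" using k(1) unfolding scalar_mod_def ..
  have "mat_red k (A ** X) = mat_red k (mat c ** X)"
    using k(2) c by (intro mat_red_mult_cong) auto
  also have "\<dots> = mat_red k (X ** B)"
    unfolding mat_mult_commute using c by (intro mat_red_mult_cong) auto
  finally have "mat_red k (A ** X) = mat_red k (X ** B)" .
  moreover have "mat_red m (A ** X) = mat_red m (X ** B)"
    using mat_red_mult_cong[OF refl X(2)] mat_red_mult_cong[OF X(2) refl] g by metis
  ultimately have "mat_red (k * m) (A ** X) = mat_red (k * m) (X ** B)"
    by (rule mat_red_coprime_mult[OF cop])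
  with X(1) show ?thesis
    using mem_conjugacy_class_ESL2_iff[OF km, of A B] A B by (auto simp: mat_red_ESL2[OF km])
qed

section \<open>Elements of given determinant and trace\<close>

definition ESL2_det_trace :: "int \<Rightarrow> int \<Rightarrow> int \<Rightarrow> (int^2^2) set"
  where "ESL2_det_trace n \<delta> t =
    {A \<in> carrier (ESL2 n). [det A = \<delta>] (mod n) \<and> [trace A = t] (mod n)}"

lemma mat_red_in_ESL2_det_trace:
  assumes "n > 0" "\<delta> \<in> {1, -1}" "[det A = \<delta>] (mod n)" "[trace A = t] (mod n)"
  shows "mat_red n A \<in> ESL2_det_trace n \<delta> t"
  using assms mat_red_in_ESL2_iff det_mat_red trace_mat_red
  unfolding ESL2_det_trace_def by (blast intro: cong_trans)

lemma mat_red_in_ESL2_det_trace_dvd: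
  assumes "m > 0" "m dvd n" "A \<in> ESL2_det_trace n \<delta> t"
  shows "mat_red m A \<in> ESL2_det_trace m \<delta> t"
proof -
  have A: "A \<in> carrier (ESL2 n)" "[det A = \<delta>] (mod m)" "[trace A = t] (mod m)"
    using assms unfolding ESL2_det_trace_def by (auto intro: cong_dvd_modulus)
  have "[det (mat_red m A) = \<delta>] (mod m)" "[trace (mat_red m A) = t] (mod m)"
    using A(2,3) by (blast intro: cong_trans det_mat_red trace_mat_red)+
  then show ?thesis
    using A(1) assms(1,2) unfolding ESL2_det_trace_def by (blast intro: mat_red_in_ESL2_dvd)
qed

lemma char_disc_cong:
  assumes "A \<in> ESL2_det_trace n \<delta> t"
  shows "[(trace A)\<^sup>2 - 4 * det A = t\<^sup>2 - 4 * \<delta>] (mod n)"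
  using assms unfolding ESL2_det_trace_def by (intro cong_diff cong_mult cong_pow cong_refl) auto

lemma companion_mat_in_ESL2:
  assumes n: "n > 0" and A: "A \<in> ESL2_det_trace n \<delta> t"
  shows "mat_red n (companion_mat t \<delta>) \<in> carrier (ESL2 n)"
proof -
  have "A \<in> carrier (ESL2 n)" and det: "[\<delta> = det A] (mod n)"
    using A by (auto simp: ESL2_det_trace_def cong_sym)
  then obtain r where "r \<in> {1, -1}" "[det A = r] (mod n)" by (auto simp: ESL2_def)
  moreover have "det (companion_mat t \<delta>) = \<delta>" by (simp add: companion_mat_def det_2)
  ultimately show ?thesis
    unfolding mat_red_in_ESL2_iff[OF n] using det by (auto intro: cong_trans)
qed

lemma conjugate_companion_mat_if_not_scalar_mod_3:
  assumes n: "n > 0" and disc: "prime_factors (gcd n (t\<^sup>2 - 4 * \<delta>)) \<subseteq> {3}"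
    and A: "A \<in> ESL2_det_trace n \<delta> t" and nonscalar: "3 dvd n \<Longrightarrow> \<not> scalar_mod 3 A"
  shows "A \<in> conjugacy_class (ESL2 n) (mat_red n (companion_mat t \<delta>))"
proof -
  have A_props: "A \<in> carrier (ESL2 n)" "[trace A = t] (mod n)" "[det A = \<delta>] (mod n)"
    using A unfolding ESL2_det_trace_def by auto
  let ?a = "A $ 2 $ 1" and ?b = "A $ 2 $ 2 - A $ 1 $ 1" and ?c = "- A $ 1 $ 2"
  have "\<exists>r\<in>{1, -1}. represents_mod n ?a ?b ?c r"
  proof (rule represents_pm1_mod)
    show "prime_factors (gcd n (binary_disc ?a ?b ?c)) \<subseteq> {3}"
      unfolding binary_disc_char_disc using disc cong_gcd_eq[OF char_disc_cong[OF A]]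
      by (simp add: gcd.commute)
    show "\<not> (3 dvd ?a \<and> 3 dvd ?b \<and> 3 dvd ?c)" if "3 dvd n"
      using nonscalar[OF that] unfolding scalar_mod_iff by auto
  qed (use n in simp)
  then obtain r x y where "r \<in> {1, -1}" "[binary_form ?a ?b ?c x y = r] (mod n)"
    unfolding represents_mod_def by blast
  moreover define g where "g = krylov_mat A (vector [x, y])"
  ultimately have g: "mat_red n g \<in> carrier (ESL2 n)"
    unfolding mat_red_in_ESL2_iff[OF n] by (auto simp: det_krylov_mat)
  have "mat_red n (A ** g) = mat_red n (g ** companion_mat (trace A) (det A))"
    by (simp add: g_def mult_krylov_mat)
  also have "\<dots> = mat_red n (g ** companion_mat t \<delta>)"
    by (intro mat_red_mult_cong refl companion_mat_cong A_props)
  finally show ?thesis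
    using g mem_conjugacy_class_ESL2_iff[OF n _ companion_mat_in_ESL2[OF n A], of A] A_props(1)
    by (auto simp: mat_red_ESL2[OF n])
qed

lemma conjugate_ESL2_if_not_scalar_mod_3:
  assumes n: "n > 0" and disc: "prime_factors (gcd n (t\<^sup>2 - 4 * \<delta>)) \<subseteq> {3}"
    and A: "A \<in> ESL2_det_trace n \<delta> t" "3 dvd n \<Longrightarrow> \<not> scalar_mod 3 A"
    and B: "B \<in> ESL2_det_trace n \<delta> t" "3 dvd n \<Longrightarrow> \<not> scalar_mod 3 B"
  shows "A \<in> conjugacy_class (ESL2 n) B"
proof -
  interpret group "ESL2 n" by (rule group_ESL2[OF n])
  let ?C = "mat_red n (companion_mat t \<delta>)"
  have carrier: "A \<in> carrier (ESL2 n)" "B \<in> carrier (ESL2 n)" "?C \<in> carrier (ESL2 n)"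
    using A(1) B(1) companion_mat_in_ESL2[OF n A(1)] by (auto simp: ESL2_det_trace_def)
  have "A \<in> conjugacy_class (ESL2 n) ?C" "B \<in> conjugacy_class (ESL2 n) ?C"
    using conjugate_companion_mat_if_not_scalar_mod_3[OF n disc] A B by auto
  then show ?thesis
    using carrier conjugacy_class_sym conjugacy_class_trans by metis
qed

lemma not_9_dvd_if_scalar_mod_3:
  assumes A: "A \<in> ESL2_det_trace n \<delta> t" and "scalar_mod 3 A" and disc: "gcd n (t\<^sup>2 - 4 * \<delta>) dvd 3"
  shows "\<not> 9 dvd n"
proof
  assume "9 dvd n"
  moreover have "9 dvd (trace A)\<^sup>2 - 4 * det A"
    using square_dvd_char_disc_if_scalar_mod[OF \<open>scalar_mod 3 A\<close>] by simp
  ultimately have "9 dvd t\<^sup>2 - 4 * \<delta>"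
    using cong_dvd_iff[OF cong_dvd_modulus[OF char_disc_cong[OF A]]] by blast
  with \<open>9 dvd n\<close> have "9 dvd gcd n (t\<^sup>2 - 4 * \<delta>)" by simp
  then have "9 dvd (3 :: int)" using disc by (rule dvd_trans)
  then show False by simp
qed

lemma prime_factors_subset_if_dvd_prime:
  fixes x p :: "'a :: factorial_semiring"
  assumes "prime p" "x dvd p"
  shows "prime_factors x \<subseteq> {p}"
  using dvd_prime_factors[of p x] prime_prime_factors[of p] assms by auto

lemma conjugate_ESL2_if_scalar_mod_3:
  assumes n: "n > 0" "3 dvd n" and disc: "gcd n (t\<^sup>2 - 4 * \<delta>) dvd 3"
    and A: "A \<in> ESL2_det_trace n \<delta> t" "scalar_mod 3 A"
    and B: "B \<in> ESL2_det_trace n \<delta> t" "scalar_mod 3 B"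
  shows "A \<in> conjugacy_class (ESL2 n) B"
proof -
  obtain m where m: "n = 3 * m" using n(2) ..
  have m_pos: "m > 0" using n(1) m by simp
  have not_dvd_m: "\<not> 3 dvd m" using not_9_dvd_if_scalar_mod_3[OF A disc] m by auto
  have "gcd m (t\<^sup>2 - 4 * \<delta>) dvd 3"
    by (rule dvd_trans[OF gcd_mono[OF _ dvd_refl] disc]) (simp add: m)
  then have "mat_red m A \<in> conjugacy_class (ESL2 m) (mat_red m B)"
    using m not_dvd_m A(1) B(1)
    by (intro conjugate_ESL2_if_not_scalar_mod_3[OF m_pos] prime_factors_subset_if_dvd_prime
        mat_red_in_ESL2_det_trace_dvd[OF m_pos]) auto
  moreover have "mat_red 3 A = mat_red 3 B"
  proof (rule mat_red_eq_if_scalar_mod)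
    have "[trace A = trace B] (mod n)"
      using A(1) B(1) unfolding ESL2_det_trace_def by (blast intro: cong_trans cong_sym)
    then show "[trace A = trace B] (mod 3)" using n(2) by (rule cong_dvd_modulus)
  qed (use A B in simp_all)
  moreover have "coprime 3 m" using not_dvd_m by (intro prime_imp_coprime) simp_all
  ultimately show ?thesis
    using A B m_pos unfolding m ESL2_det_trace_def by (intro conjugate_ESL2_coprime_mult) auto
qed

theorem conjugacy_class_ESL2_eq:
  assumes n: "n > 0" and disc: "gcd n (t\<^sup>2 - 4 * \<delta>) dvd 3" and B: "B \<in> ESL2_det_trace n \<delta> t"
  shows "conjugacy_class (ESL2 n) B =
    {A \<in> ESL2_det_trace n \<delta> t. 3 dvd n \<longrightarrow> (scalar_mod 3 A \<longleftrightarrow> scalar_mod 3 B)}"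
    (is "?C = ?R")
proof
  interpret group "ESL2 n" by (rule group_ESL2[OF n])
  have B_carrier: "B \<in> carrier (ESL2 n)" using B unfolding ESL2_det_trace_def by simp
  show "?C \<subseteq> ?R"
  proof
    fix A assume A: "A \<in> ?C"
    then have A_carrier: "A \<in> carrier (ESL2 n)" using B_carrier by (auto simp: conjugacy_class_def)
    have "A \<in> ESL2_det_trace n \<delta> t"
      using det_conjugate_ESL2[OF n B_carrier A] trace_conjugate_ESL2[OF n B_carrier A] A_carrier B
      unfolding ESL2_det_trace_def by (blast intro: cong_trans)
    moreover have "B \<in> conjugacy_class (ESL2 n) A"
      using B_carrier A_carrier A by (rule conjugacy_class_sym)
    ultimately show "A \<in> ?R"
      using scalar_mod_conjugate_ESL2[OF n] A A_carrier B_carrier by blast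
  qed
  have "prime_factors (gcd n (t\<^sup>2 - 4 * \<delta>)) \<subseteq> {3}"
    using disc by (intro prime_factors_subset_if_dvd_prime) simp_all
  then show "?R \<subseteq> ?C"
    using conjugate_ESL2_if_not_scalar_mod_3[OF n _ _ _ B] conjugate_ESL2_if_scalar_mod_3[OF n _ disc _ _ B]
    by blast
qed

corollary ESL2_det_trace_eq_conjugacy_class:
  assumes n: "n > 0" and disc: "gcd n (t\<^sup>2 - 4 * \<delta>) dvd 3" and B: "B \<in> ESL2_det_trace n \<delta> t"
    and nine_dvd: "3 dvd n \<Longrightarrow> 9 dvd n"
  shows "ESL2_det_trace n \<delta> t = conjugacy_class (ESL2 n) B"
proof -
  have "\<not> scalar_mod 3 A" if "3 dvd n" "A \<in> ESL2_det_trace n \<delta> t" for A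
    using not_9_dvd_if_scalar_mod_3[OF that(2) _ disc] nine_dvd[OF that(1)] by blast
  then show ?thesis unfolding conjugacy_class_ESL2_eq[OF n disc B] using B by blast
qed

corollary ESL2_det_trace_eq_two_conjugacy_classes:
  assumes n: "n > 0" "3 dvd n" and disc: "gcd n (t\<^sup>2 - 4 * \<delta>) dvd 3"
    and A: "A \<in> ESL2_det_trace n \<delta> t" "\<not> scalar_mod 3 A"
    and B: "B \<in> ESL2_det_trace n \<delta> t" "scalar_mod 3 B"
  shows "ESL2_det_trace n \<delta> t = conjugacy_class (ESL2 n) A \<union> conjugacy_class (ESL2 n) B"
    and "conjugacy_class (ESL2 n) A \<inter> conjugacy_class (ESL2 n) B = {}"
  unfolding conjugacy_class_ESL2_eq[OF n(1) disc A(1)] conjugacy_class_ESL2_eq[OF n(1) disc B(1)]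
  using n(2) A(2) B(2) by auto

section \<open>The modulus \<open>dbar d\<close>\<close>

lemma dbar_pos: "d > 0 \<Longrightarrow> dbar d > 0"
  by (simp add: dbar_def)

lemma odd_dvd_dbar_iff: "odd k \<Longrightarrow> k dvd dbar d \<longleftrightarrow> k dvd d"
  by (simp add: dbar_def coprime_dvd_mult_right_iff)

lemma dbar_dvd_mult: "(even d \<Longrightarrow> even k) \<Longrightarrow> dbar d dvd d * k"
  by (auto simp: dbar_def mult_dvd_mono mult.commute)

lemma gcd_dbar_char_disc_dvd_3: "gcd (dbar d) ((d - 1)\<^sup>2 - 4 * 1) dvd 3"
proof -
  let ?g = "gcd (dbar d) ((d - 1)\<^sup>2 - 4 * 1)"
  have "dbar d dvd d * (d - 2)" by (rule dbar_dvd_mult) simp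
  then have "?g dvd d * (d - 2)" by (rule dvd_trans[OF gcd_dvd1])
  then have "?g dvd d * (d - 2) - ((d - 1)\<^sup>2 - 4 * 1)" by (rule dvd_diff) (rule gcd_dvd2)
  also have "d * (d - 2) - ((d - 1)\<^sup>2 - 4 * 1) = 3" by (simp add: power2_eq_square algebra_simps)
  finally show ?thesis .
qed

lemma Fz_in_ESL2_det_trace:
  assumes "d > 0"
  shows "Fz d \<in> ESL2_det_trace (dbar d) 1 (d - 1)"
  unfolding Fz_def
proof (rule mat_red_in_ESL2_det_trace)
  have "det (mat2 0 (d - 1) (d + 1) (d - 1)) - 1 = d * - d"
    by (simp add: det_2 algebra_simps)
  also have "dbar d dvd \<dots>" by (rule dbar_dvd_mult) simp
  finally show "[det (mat2 0 (d - 1) (d + 1) (d - 1)) = 1] (mod dbar d)"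
    by (simp add: cong_iff_dvd_diff)
qed (use assms in \<open>simp_all add: dbar_pos trace_2\<close>)

lemma not_scalar_mod_3_Fz:
  assumes "3 dvd d"
  shows "\<not> scalar_mod 3 (Fz d)"
proof -
  have n: "3 dvd dbar d" using assms by (simp add: odd_dvd_dbar_iff)
  have "\<not> 3 dvd d - 1" using assms by presburger
  then show ?thesis unfolding Fz_def scalar_mod_mat_red[OF n] by (simp add: scalar_mod_iff)
qed

lemma mat2_1_in_ESL2_det_trace:
  assumes "d > 0" and c: "3 * c = 2 * i * d - 3"
  shows "mat_red (dbar d) (mat2 1 (d + 3) c (d - 2)) \<in> ESL2_det_trace (dbar d) 1 (d - 1)"
proof (rule mat_red_in_ESL2_det_trace)
  have "even (3 * c + 3)" unfolding c by simp
  then have "even (1 - c - 2 * i)" by simp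
  then have dvd: "dbar d dvd d * (1 - c - 2 * i)" by (rule dbar_dvd_mult)
  have "det (mat2 1 (d + 3) c (d - 2)) - 1 = d * (1 - c) - (3 * c + 3)"
    by (simp add: det_2 algebra_simps)
  also have "\<dots> = d * (1 - c - 2 * i)" unfolding c by (simp add: algebra_simps)
  finally show "[det (mat2 1 (d + 3) c (d - 2)) = 1] (mod dbar d)"
    using dvd by (simp add: cong_iff_dvd_diff)
qed (use assms in \<open>simp_all add: dbar_pos trace_2\<close>)

lemma scalar_mod_3_mat2_1:
  assumes "3 dvd d" "3 dvd c"
  shows "scalar_mod 3 (mat_red (dbar d) (mat2 1 (d + 3) c (d - 2)))"
proof -
  have n: "3 dvd dbar d" using assms(1) by (simp add: odd_dvd_dbar_iff)
  show ?thesis using assms unfolding scalar_mod_mat_red[OF n] by (simp add: scalar_mod_iff)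
qed

lemma
  assumes "d > 0" "[d = 3] (mod 9)"
  shows Fa_in_ESL2_det_trace: "Fa d \<in> ESL2_det_trace (dbar d) 1 (d - 1)"
    and scalar_mod_3_Fa: "scalar_mod 3 (Fa d)"
proof -
  have "3 * ((4 * d - 3) div 3) = 2 * 2 * d - 3" "3 dvd (4 * d - 3) div 3" "3 dvd d"
    using assms(2) unfolding cong_iff_dvd_diff by presburger+
  then show "Fa d \<in> ESL2_det_trace (dbar d) 1 (d - 1)" "scalar_mod 3 (Fa d)"
    unfolding Fa_def using assms(1) by (blast intro: mat2_1_in_ESL2_det_trace scalar_mod_3_mat2_1)+
qed

lemma
  assumes "d > 0" "[d = 6] (mod 9)"
  shows Fa'_in_ESL2_det_trace: "Fa' d \<in> ESL2_det_trace (dbar d) 1 (d - 1)"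
    and scalar_mod_3_Fa': "scalar_mod 3 (Fa' d)"
proof -
  have "3 * ((2 * d - 3) div 3) = 2 * 1 * d - 3" "3 dvd (2 * d - 3) div 3" "3 dvd d"
    using assms(2) unfolding cong_iff_dvd_diff by presburger+
  then show "Fa' d \<in> ESL2_det_trace (dbar d) 1 (d - 1)" "scalar_mod 3 (Fa' d)"
    unfolding Fa'_def using assms(1) by (blast intro: mat2_1_in_ESL2_det_trace scalar_mod_3_mat2_1)+
qed

theorem theorem3p12:
  fixes d :: int
  assumes "d \<ge> 4"
  defines "G \<equiv> ESL2 (dbar d)"
  defines "S \<equiv> {A \<in> carrier G. [det A = 1] (mod dbar d) \<and> [trace A = d - 1] (mod dbar d)}"
  shows "(\<not> [d = 3] (mod 9) \<and> \<not> [d = 6] (mod 9) \<longrightarrow>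
            S = conjugacy_class G (Fz d)) \<and>
         ([d = 3] (mod 9) \<longrightarrow>
            S = conjugacy_class G (Fz d) \<union> conjugacy_class G (Fa d) \<and>
            conjugacy_class G (Fz d) \<inter> conjugacy_class G (Fa d) = {}) \<and>
         ([d = 6] (mod 9) \<longrightarrow>
            S = conjugacy_class G (Fz d) \<union> conjugacy_class G (Fa' d) \<and>
            conjugacy_class G (Fz d) \<inter> conjugacy_class G (Fa' d) = {})"
proof -
  have d: "d > 0" and n: "dbar d > 0" using assms(1) by (simp_all add: dbar_pos)
  have three_dvd: "3 dvd dbar d \<longleftrightarrow> 3 dvd d" by (simp add: odd_dvd_dbar_iff)
  have S: "S = ESL2_det_trace (dbar d) 1 (d - 1)" unfolding S_def G_def ESL2_det_trace_def ..
  note disc = gcd_dbar_char_disc_dvd_3[of d]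
  note Fz = Fz_in_ESL2_det_trace[OF d]
  note two_classes =
    ESL2_det_trace_eq_two_conjugacy_classes[OF n _ disc Fz not_scalar_mod_3_Fz, folded S G_def]
  show ?thesis
  proof (intro conjI impI)
    assume "\<not> [d = 3] (mod 9) \<and> \<not> [d = 6] (mod 9)"
    then have "3 dvd d \<longrightarrow> 9 dvd d" unfolding cong_iff_dvd_diff by presburger
    then show "S = conjugacy_class G (Fz d)"
      unfolding S G_def
      by (intro ESL2_det_trace_eq_conjugacy_class[OF n disc Fz]) (simp add: odd_dvd_dbar_iff)
  next
    assume mod9: "[d = 3] (mod 9)"
    then have "3 dvd dbar d" "3 dvd d" unfolding three_dvd cong_iff_dvd_diff by presburger+
    note two_classes[OF this Fa_in_ESL2_det_trace[OF d mod9, folded S] scalar_mod_3_Fa[OF d mod9]]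
    then show "S = conjugacy_class G (Fz d) \<union> conjugacy_class G (Fa d)"
      "conjugacy_class G (Fz d) \<inter> conjugacy_class G (Fa d) = {}" .
  next
    assume mod9: "[d = 6] (mod 9)"
    then have "3 dvd dbar d" "3 dvd d" unfolding three_dvd cong_iff_dvd_diff by presburger+
    note two_classes[OF this Fa'_in_ESL2_det_trace[OF d mod9, folded S] scalar_mod_3_Fa'[OF d mod9]]
    then show "S = conjugacy_class G (Fz d) \<union> conjugacy_class G (Fa' d)"
      "conjugacy_class G (Fz d) \<inter> conjugacy_class G (Fa' d) = {}" .
  qed
qed

end
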